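(* Let $A\in M_q(\mathbb{R})$ be a real matrix and let $\mathbb{S}=\widetilde{S}\cup\mathcal{S}^{+}_1\cup\mathcal{S}^{+}_2$. Then the sequence of matrices obtained by plugging $-k$ for $k$ in the geometric part of $A$ relative to $(\mathbb{S},\mathcal{T})$ is $\pmb{A}_d-\pi_0\pmb{0}_0$, where $\pmb{A}_d=(A_d^k)_{k\ge0}$, $A_d$ is the Drazin inverse of $A$, and $\pi_0$ is the spectral projection of $A$ at $0$.
   Context: All sequences are indexed by $k\ge0$ with componentwise operations; sequences of matrices are identified with matrices of sequences; zeroth powers are identities. $\widetilde{S}=\{\pmb{\lambda}=(\lambda^k)_{k\ge0}:\lambda\in\mathbb{R},\lambda\ne0\}$. For $r>0$ and $\vartheta\in\,]0,\pi[$ put $[r,\cos(\vartheta)]=(r^k\cos(k\vartheta))_{k\ge0}$ and $[r,\sin(\vartheta)]=(r^k\sin(k\vartheta))_{k\ge0}$; $\mathcal{S}^{+}_1=\{[r,\cos(\vartheta)]:r>0,\vartheta\in\,]0,\pi[\}$ and $\mathcal{S}^{+}_2=\{[r,\sin(\vartheta)]:r>0,\vartheta\in\,]0,\pi[\}$. $\pmb{0}_i$ is the sequence with $\pmb{0}_i(k)=\delta_{ik}$, $\mathcal{S}^{\circ}=\{\pmb{0}_i:i\ge0\}$. $\pmb{\Lambda}_i=(\binom{k}{i})_{k\ge0}$ and $\mathcal{T}=\{\pmb{\Lambda}_i:i\ge0\}$. $\mathbb{R}_{\mathcal{S}^{\circ}}$ and $\mathbb{R}_{\mathbb{S}}$ are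 the real spans of $\mathcal{S}^{\circ}$ and $\mathbb{S}$. The set $\mathcal{S}^{\circ}\cup\{\pmb{s}\,\pmb{\Lambda}_i:\pmb{s}\in\mathbb{S},i\ge0\}$ is a basis of the real vector space of all real linear recurrence sequences. Hence for $A\in M_q(\mathbb{R})$ the sequence $(A^k)_{k\ge0}$ can be written uniquely (up to zero terms) as $\pmb{N}(A)+\pmb{\mathcal{B}}_0\pmb{\Lambda}_0+\cdots+\pmb{\mathcal{B}}_l\pmb{\Lambda}_l$ with $\pmb{N}(A)\in M_q(\mathbb{R}_{\mathcal{S}^{\circ}})$ and $\pmb{\mathcal{B}}_i\in M_q(\mathbb{R}_{\mathbb{S}})$; the sum $\pmb{\mathcal{B}}_0\pmb{\Lambda}_0+\cdots+\pmb{\mathcal{B}}_l\pmb{\Lambda}_l$ is the geometric part of $A$ relative to $(\mathbb{S},\mathcal{T})$. Plugging $-k$ for $k$ in it means replacing $(\lambda^k)_k$ by $(\lambda^{-k})_k$, $[r,\cos(\vartheta)]$ by $(r^{-k}\cos(-k\vartheta))_k$, $[r,\sin(\vartheta)]$ by $(r^{-k}\sin(-k\vartheta))_k$, and $(\binom{k}{i})_k$ by $(\binom{-k}{i})_k$. $\pi_0$ is the projection onto the generalized eigenspace of $A$ at $0$ along the sum of the other (complex) generalized eigenspaces, i.e. onto $\ker A^q$ along $\operatorname{im}A^q$ ($\pi_0=0$ if $A$ is nonsingular). The Drazin inverse $A_d$ is the unique matrix $B$ with $A^{k}BA=A^{k}$ for some $k\ge0$, $AB=BA$, $BAB=B$.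 *)

theory Defs
  imports "HOL-Analysis.Analysis" "HOL-Library.Function_Algebras"
begin

text \<open>Real vector space structure on functions, so that \<open>span\<close> applies to
  real sequences. Products \<open>s * t\<close> of sequences are pointwise.\<close>

instantiation "fun" :: (type, real_vector) real_vector
begin

definition scaleR_fun_def: "c *\<^sub>R f = (\<lambda>x. c *\<^sub>R f x)"

instance
  by standard (simp_all add: scaleR_fun_def fun_eq_iff algebra_simps)

end

section \<open>Families of real sequences\<close>

definition geom_seq :: "real \<Rightarrow> nat \<Rightarrow> real" where
  "geom_seq x = (\<lambda>k. x ^ k)"

definition cos_seq :: "real \<Rightarrow> real \<Rightarrow> nat \<Rightarrow> real" where
  "cos_seq r \<theta> = (\<lambda>k. r ^ k * cos (real k * \<theta>))"

definition sin_seq :: "real \<Rightarrow> real \<Rightarrow> nat \<Rightarrow> real" where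
  "sin_seq r \<theta> = (\<lambda>k. r ^ k * sin (real k * \<theta>))"

definition delta_seq :: "nat \<Rightarrow> nat \<Rightarrow> real" where
  "delta_seq i = (\<lambda>k. if k = i then 1 else 0)"

definition Lambda_seq :: "nat \<Rightarrow> nat \<Rightarrow> real" where
  "Lambda_seq i = (\<lambda>k. real (k choose i))"

definition S_tilde :: "(nat \<Rightarrow> real) set" where
  "S_tilde = {geom_seq x | x. x \<noteq> 0}"

definition S_plus1 :: "(nat \<Rightarrow> real) set" where
  "S_plus1 = {cos_seq r \<theta> | r \<theta>. 0 < r \<and> 0 < \<theta> \<and> \<theta> < pi}"

definition S_plus2 :: "(nat \<Rightarrow> real) set" where
  "S_plus2 = {sin_seq r \<theta> | r \<theta>. 0 < r \<and> 0 < \<theta> \<and> \<theta> < pi}"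

definition S_circ :: "(nat \<Rightarrow> real) set" where
  "S_circ = range delta_seq"

section \<open>Matrices\<close>

text \<open>On \<open>real^'n^'n\<close> the symbols \<open>*\<close> and \<open>^\<close> are componentwise;
  the power below is the one for the matrix product.\<close>

definition mat_power :: "real^'n^'n \<Rightarrow> nat \<Rightarrow> real^'n^'n" where
  "mat_power A k = (((**) A) ^^ k) (mat 1)"

definition is_drazin_inverse :: "real^'n^'n \<Rightarrow> real^'n^'n \<Rightarrow> bool" where
  "is_drazin_inverse A B \<longleftrightarrow>
     (\<exists>k. mat_power A k ** B ** A = mat_power A k) \<and> A ** B = B ** A \<and> B ** A ** B = B"

definition drazin_inverse :: "real^'n^'n \<Rightarrow> real^'n^'n" where
  "drazin_inverse A = (THE B. is_drazin_inverse A B)"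

text \<open>The projection onto \<open>ker A^q\<close> along \<open>im A^q\<close>, where \<open>q = CARD('n)\<close>.\<close>

definition spectral_proj0 :: "real^'n^'n \<Rightarrow> real^'n^'n" where
  "spectral_proj0 A = (THE P. P ** P = P \<and>
     range ((*v) P) = {x. mat_power A CARD('n) *v x = 0} \<and>
     {x. P *v x = 0} = range ((*v) (mat_power A CARD('n))))"

section \<open>The geometric part of a matrix and its reflection\<close>

text \<open>\<open>N + B 0 \<Lambda>\<^sub>0 + \<dots> + B l \<Lambda>\<^sub>l\<close> is a decomposition of the sequence of powers of \<open>A\<close>.
  A sequence of matrices belongs to \<open>M\<^sub>q\<close> of a space of sequences if all its
  entry sequences belong to that space.\<close>

definition geometric_decomposition ::
  "(nat \<Rightarrow> real) set \<Rightarrow> real^'n^'n \<Rightarrow> (nat \<Rightarrow> real^'n^'n) \<Rightarrow> nat \<Rightarrow> (nat \<Rightarrow> nat \<Rightarrow> real^'n^'n) \<Rightarrow> bool"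
where
  "geometric_decomposition \<S> A N l B \<longleftrightarrow>
     (\<forall>a b. (\<lambda>k. N k $ a $ b) \<in> span S_circ) \<and>
     (\<forall>i\<le>l. \<forall>a b. (\<lambda>k. B i k $ a $ b) \<in> span \<S>) \<and>
     (\<forall>k. mat_power A k = N k + (\<Sum>i\<le>l. Lambda_seq i k *\<^sub>R B i k))"

definition geometric_part :: "(nat \<Rightarrow> real) set \<Rightarrow> real^'n^'n \<Rightarrow> nat \<Rightarrow> real^'n^'n" where
  "geometric_part \<S> A = (THE G. \<exists>N l B. geometric_decomposition \<S> A N l B \<and>
     G = (\<lambda>k. \<Sum>i\<le>l. Lambda_seq i k *\<^sub>R B i k))"

text \<open>Pairs of a generating sequence and the sequence obtained from its defining
  expression by writing \<open>-k\<close> for \<open>k\<close>. The reflected binomial is the generalized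
  binomial coefficient at \<open>-k\<close>.\<close>

definition reflection_pairs :: "((nat \<Rightarrow> real) \<times> (nat \<Rightarrow> real)) set" where
  "reflection_pairs =
     {(geom_seq x, \<lambda>k. x powi (- int k)) | x. x \<noteq> 0} \<union>
     {(cos_seq r \<theta>, \<lambda>k. r powi (- int k) * cos (- real k * \<theta>)) | r \<theta>. 0 < r \<and> 0 < \<theta> \<and> \<theta> < pi} \<union>
     {(sin_seq r \<theta>, \<lambda>k. r powi (- int k) * sin (- real k * \<theta>)) | r \<theta>. 0 < r \<and> 0 < \<theta> \<and> \<theta> < pi}"

definition basis_reflection_pairs :: "((nat \<Rightarrow> real) \<times> (nat \<Rightarrow> real)) set" where
  "basis_reflection_pairs =
     {(s * Lambda_seq i, t * (\<lambda>k. (- real k) gchoose i)) | s t i. (s, t) \<in> reflection_pairs}"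

text \<open>The linear extension of the replacement on the basis elements \<open>s \<Lambda>\<^sub>i\<close>.
  The span of the pairs, taken in the product space, is the graph of that linear map;
  it is single-valued because the sequences \<open>s \<Lambda>\<^sub>i\<close> are linearly independent.\<close>

definition plug_neg :: "(nat \<Rightarrow> real) \<Rightarrow> nat \<Rightarrow> real" where
  "plug_neg a = (THE b. (a, b) \<in> span basis_reflection_pairs)"

definition plug_neg_mat :: "(nat \<Rightarrow> real^'n^'n) \<Rightarrow> nat \<Rightarrow> real^'n^'n" where
  "plug_neg_mat G = (\<lambda>k. \<chi> a b. plug_neg (\<lambda>m. G m $ a $ b) k)"

end

theory Submission
  imports Defs "HOL-Computational_Algebra.Fundamental_Theorem_Algebra"
begin

text \<open>Write \<open>B\<close> for the Drazin inverse of \<open>A\<close> and \<open>E = A ** B\<close>, an idempotent with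
  \<open>\<pi>\<^sub>0 = 1 - E\<close>. The sequence \<open>C\<close> indexed by the integers, with \<open>C z = A\<^sup>z E\<close> for
  \<open>z \<ge> 0\<close> and \<open>C z = B\<^sup>-\<^sup>z\<close> for \<open>z < 0\<close>, satisfies \<open>C (z + 1) = A C z\<close> on all of the integers
  (\<open>two_sided_powers_step\<close>). Its non-negative half is the geometric part of \<open>A\<close>, because
  \<open>A\<^sup>k (1 - E)\<close> vanishes for large \<open>k\<close>, and its reflected non-positive half is
  \<open>B\<^sup>k - \<delta>\<^sub>0\<^sub>k \<pi>\<^sub>0\<close>. The theorem thus says that plugging \<open>-k\<close> for \<open>k\<close> is evaluation of a
  two-sided sequence at negative integers.

  Both existence and uniqueness are obtained from the space \<open>exp_poly\<close> of two-sided complex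
  sequences annihilated by a product of operators \<open>T - \<mu>\<close> with \<open>\<mu> \<noteq> 0\<close>, where \<open>T\<close> is the shift.
  Since \<open>\<mu> \<noteq> 0\<close>, such a recurrence can be run backwards, so a member that vanishes at all large
  indices is zero (\<open>exp_poly_eventually_zero\<close>). All pairs in the graph of the reflection are
  the two halves of such a sequence (\<open>pair_extends_to_exp_poly\<close>); hence the graph is single-valued,
  and a reflectable sequence is determined by its tail, which makes the geometric part unique. No
  linear independence of the generating sequences is needed.

  Conversely, every member of \<open>exp_poly\<close> is a combination of the sequences
  \<open>\<mu>\<^sup>k (k choose i)\<close> (\<open>exp_poly_in_span\<close>), because each \<open>T - \<nu>\<close> with \<open>\<nu> \<noteq> 0\<close> maps
  their span onto itself and has the multiples of \<open>\<nu>\<^sup>k\<close> as kernel; taking real parts gives a pair in the graph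
  (\<open>exp_poly_gives_pair\<close>). The entries of \<open>C\<close> belong to \<open>exp_poly\<close>: they are annihilated by
  \<open>p(T)\<close> for every real polynomial \<open>p\<close> with \<open>p(A) = 0\<close>; a non-zero such \<open>p\<close> exists and splits
  over the complex numbers, and factors \<open>T\<close> of \<open>p(T)\<close> can be cancelled as \<open>T\<close> is invertible on
  two-sided sequences.\<close>

section \<open>Two-sided exponential polynomials\<close>

text \<open>The two-sided complex sequences annihilated by some product of operators
  \<open>T - \<mu>\<close> with \<open>\<mu> \<noteq> 0\<close>, where \<open>(T c) k = c (k + 1)\<close>. The inductive form lists the factors of
  the product one at a time; as the operators commute, their order is immaterial.\<close>

inductive_set exp_poly :: "(int \<Rightarrow> complex) set" where
  exp_poly_zero: "(\<lambda>_. 0) \<in> exp_poly"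
| exp_poly_step:
    "\<mu> \<noteq> 0 \<Longrightarrow> (\<lambda>k. c (k + 1) - \<mu> * c k) \<in> exp_poly \<Longrightarrow> c \<in> exp_poly"

lemma exp_poly_shift: "c \<in> exp_poly \<Longrightarrow> (\<lambda>k. c (k + z)) \<in> exp_poly"
proof (induction rule: exp_poly.induct)
  case (exp_poly_step \<mu> c)
  show ?case
    by (rule exp_poly.exp_poly_step[OF exp_poly_step.hyps(1)])
      (use exp_poly_step.IH in \<open>simp add: ac_simps\<close>)
qed (simp add: exp_poly_zero)

lemma exp_poly_scale: "c \<in> exp_poly \<Longrightarrow> (\<lambda>k. \<alpha> * c k) \<in> exp_poly"
proof (induction rule: exp_poly.induct)
  case (exp_poly_step \<mu> c)
  show ?case
    by (rule exp_poly.exp_poly_step[OF exp_poly_step.hyps(1)])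
      (use exp_poly_step.IH in \<open>simp add: algebra_simps\<close>)
qed (simp add: exp_poly_zero)

lemma exp_poly_diff_op: "c \<in> exp_poly \<Longrightarrow> (\<lambda>k. c (k + 1) - \<nu> * c k) \<in> exp_poly"
proof (induction rule: exp_poly.induct)
  case (exp_poly_step \<mu> c)
  show ?case
    by (rule exp_poly.exp_poly_step[OF exp_poly_step.hyps(1)])
      (use exp_poly_step.IH in \<open>simp add: algebra_simps\<close>)
qed (simp add: exp_poly_zero)

lemma exp_poly_add: "c \<in> exp_poly \<Longrightarrow> d \<in> exp_poly \<Longrightarrow> (\<lambda>k. c k + d k) \<in> exp_poly"
proof (induction arbitrary: d rule: exp_poly.induct)
  case (exp_poly_step \<mu> c)
  have "(\<lambda>k. (c (k + 1) - \<mu> * c k) + (d (k + 1) - \<mu> * d k)) \<in> exp_poly"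
    by (rule exp_poly_step.IH[OF exp_poly_diff_op[OF exp_poly_step.prems]])
  then have "(\<lambda>k. (c (k + 1) + d (k + 1)) - \<mu> * (c k + d k)) \<in> exp_poly"
    by (simp add: algebra_simps)
  then show ?case
    by (rule exp_poly.exp_poly_step[OF exp_poly_step.hyps(1)])
qed simp

text \<open>The recurrence is run backwards from the zero tail, dividing by \<open>\<mu>\<close> in each step.\<close>

lemma exp_poly_eventually_zero:
  "c \<in> exp_poly \<Longrightarrow> (\<And>k. k \<ge> K \<Longrightarrow> c k = 0) \<Longrightarrow> c k = 0"
proof (induction arbitrary: k rule: exp_poly.induct)
  case (exp_poly_step \<mu> c)
  have rec: "c (j + 1) - \<mu> * c j = 0" for j
    by (rule exp_poly_step.IH) (simp add: exp_poly_step.prems)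
  show ?case
  proof (cases "k \<ge> K")
    case False
    then have "k \<le> K" by simp
    then show ?thesis
    proof (induction rule: int_le_induct)
      case base
      then show ?case by (simp add: exp_poly_step.prems)
    next
      case (step i)
      then show ?case using rec[of "i - 1"] exp_poly_step.hyps by simp
    qed
  qed (simp add: exp_poly_step.prems)
qed simp

text \<open>The two-sided sequence \<open>\<mu>\<^sup>k (k choose i)\<close>, with the generalized binomial coefficient at
  negative \<open>k\<close>. The coefficient is formed in the reals, to agree with the reflected
  real sequences.\<close>

definition exp_binom :: "complex \<Rightarrow> nat \<Rightarrow> int \<Rightarrow> complex" where
  "exp_binom \<mu> i k = \<mu> powi k * of_real (of_int k gchoose i)"

lemma exp_binom_0_step: "\<mu> \<noteq> 0 \<Longrightarrow> exp_binom \<mu> 0 (k + 1) = \<mu> * exp_binom \<mu> 0 k"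
  by (simp add: exp_binom_def power_int_add_1)

lemma exp_binom_Suc_step:
  "\<mu> \<noteq> 0 \<Longrightarrow> exp_binom \<mu> (Suc i) (k + 1) = \<mu> * exp_binom \<mu> (Suc i) k + \<mu> * exp_binom \<mu> i k"
  by (simp add: exp_binom_def power_int_add_1 gbinomial_Suc_Suc ring_distribs mult.assoc mult.left_commute)

lemma exp_binom_in_exp_poly: "\<mu> \<noteq> 0 \<Longrightarrow> exp_binom \<mu> i \<in> exp_poly"
proof (induction i)
  case 0
  then have "(\<lambda>k. exp_binom \<mu> 0 (k + 1) - \<mu> * exp_binom \<mu> 0 k) \<in> exp_poly"
    by (simp add: exp_binom_0_step exp_poly_zero)
  with 0 show ?case by (rule exp_poly_step)
next
  case (Suc i)
  then have "(\<lambda>k. exp_binom \<mu> (Suc i) (k + 1) - \<mu> * exp_binom \<mu> (Suc i) k) \<in> exp_poly"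
    by (simp add: exp_binom_Suc_step exp_poly_scale)
  with Suc.prems show ?case by (rule exp_poly_step)
qed

text \<open>The complex multiples are put into the generating set, so that the real span of this
  set is the complex span of the sequences \<open>exp_binom \<mu> i\<close>.\<close>

definition exp_binoms :: "(int \<Rightarrow> complex) set" where
  "exp_binoms = {\<lambda>k. \<alpha> * exp_binom \<mu> i k | \<alpha> \<mu> i. \<mu> \<noteq> 0}"

lemma exp_binom_in_span: "\<mu> \<noteq> 0 \<Longrightarrow> (\<lambda>k. \<alpha> * exp_binom \<mu> i k) \<in> span exp_binoms"
  unfolding exp_binoms_def by (rule span_base) blast

text \<open>For \<open>\<mu> = \<nu>\<close> (resonance) the preimage raises the binomial index by one; for \<open>\<mu> \<noteq> \<nu>\<close>
  it has the same index, up to a correction of lower index.\<close>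

lemma exp_binoms_preimage:
  assumes "\<mu> \<noteq> 0"
  shows "\<exists>u \<in> span exp_binoms. \<forall>k. u (k + 1) - \<nu> * u k = \<alpha> * exp_binom \<mu> i k"
proof (cases "\<mu> = \<nu>")
  case True
  have "(\<lambda>k. \<alpha> / \<mu> * exp_binom \<mu> (Suc i) k) \<in> span exp_binoms"
    using assms by (rule exp_binom_in_span)
  then show ?thesis
    by (rule bexI[rotated]) (use assms True in \<open>auto simp: exp_binom_Suc_step field_simps\<close>)
next
  case False
  show ?thesis
  proof (induction i arbitrary: \<alpha>)
    case 0
    have "(\<lambda>k. \<alpha> / (\<mu> - \<nu>) * exp_binom \<mu> 0 k) \<in> span exp_binoms"
      using assms by (rule exp_binom_in_span)
    then show ?case
      by (rule bexI[rotated]) (use assms False in \<open>auto simp: exp_binom_0_step divide_simps\<close>,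
          simp_all add: algebra_simps)
  next
    case (Suc i)
    define \<beta> where "\<beta> = \<alpha> / (\<mu> - \<nu>)"
    have \<beta>: "\<beta> * (\<mu> - \<nu>) = \<alpha>" using False by (simp add: \<beta>_def)
    obtain u where u: "u \<in> span exp_binoms" "\<And>k. u (k + 1) - \<nu> * u k = (- \<beta> * \<mu>) * exp_binom \<mu> i k"
      using Suc[of "- \<beta> * \<mu>"] by blast
    have "(\<lambda>k. \<beta> * exp_binom \<mu> (Suc i) k) \<in> span exp_binoms"
      using assms by (rule exp_binom_in_span)
    from span_add[OF this u(1)]
    have "(\<lambda>k. \<beta> * exp_binom \<mu> (Suc i) k + u k) \<in> span exp_binoms"
      by (simp add: plus_fun_def)
    moreover have "(\<beta> * exp_binom \<mu> (Suc i) (k + 1) + u (k + 1)) - \<nu> * (\<beta> * exp_binom \<mu> (Suc i) k + u k)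
        = \<alpha> * exp_binom \<mu> (Suc i) k" for k
      using u(2)[of k] unfolding \<beta>[symmetric] exp_binom_Suc_step[OF assms] by (simp add: algebra_simps)
    ultimately show ?case
      by (intro bexI[of _ "\<lambda>k. \<beta> * exp_binom \<mu> (Suc i) k + u k"]) auto
  qed
qed

lemma diff_op_surj:
  assumes "w \<in> span exp_binoms"
  shows "\<exists>u \<in> span exp_binoms. \<forall>k. u (k + 1) - \<nu> * u k = w k"
  using assms
proof (induction rule: span_induct_alt)
  case base
  then show ?case by (intro bexI[of _ 0] span_zero) (simp add: zero_fun_def)
next
  case (step t x y)
  from step obtain \<alpha> \<mu> i where x: "x = (\<lambda>k. \<alpha> * exp_binom \<mu> i k)" "\<mu> \<noteq> 0"
    by (auto simp: exp_binoms_def)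
  obtain u where u: "u \<in> span exp_binoms" "\<And>k. u (k + 1) - \<nu> * u k = x k"
    using exp_binoms_preimage[OF x(2), of \<nu> \<alpha> i] x(1) by auto
  obtain v where v: "v \<in> span exp_binoms" "\<And>k. v (k + 1) - \<nu> * v k = y k"
    using step by auto
  have "t *\<^sub>R u + v \<in> span exp_binoms"
    by (intro span_add span_scale u v)
  moreover have "(t *\<^sub>R u + v) (k + 1) - \<nu> * (t *\<^sub>R u + v) k = (t *\<^sub>R x + y) k" for k
    by (simp add: scaleR_fun_def u(2)[symmetric] v(2)[symmetric] algebra_simps)
  ultimately show ?case by blast
qed

text \<open>Induction on the number of factors: a preimage \<open>u\<close> of \<open>(T - \<mu>) c\<close> exists in the span, and
  \<open>c - u\<close>, annihilated by \<open>T - \<mu>\<close>, is a multiple of \<open>\<mu>\<^sup>k\<close>.\<close>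

lemma exp_poly_in_span: "c \<in> exp_poly \<Longrightarrow> c \<in> span exp_binoms"
proof (induction rule: exp_poly.induct)
  case exp_poly_zero
  show ?case using span_zero[of exp_binoms] by (simp add: zero_fun_def)
next
  case (exp_poly_step \<mu> c)
  obtain u where u: "u \<in> span exp_binoms" "\<And>k. u (k + 1) - \<mu> * u k = c (k + 1) - \<mu> * c k"
    using diff_op_surj[OF exp_poly_step.IH, of \<mu>] by blast
  define d where "d k = c k - u k" for k
  have rec: "d (k + 1) = \<mu> * d k" for k
    using u(2)[of k] by (simp add: d_def algebra_simps)
  have "d k = d 0 * exp_binom \<mu> 0 k" for k
  proof (induction k rule: int_induct[of _ 0])
    case base
    then show ?case by (simp add: exp_binom_def)
  next
    case (step1 i)
    then show ?case using rec[of i] exp_poly_step.hyps by (simp add: exp_binom_0_step)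
  next
    case (step2 i)
    then show ?case
      using rec[of "i - 1"] exp_binom_0_step[OF exp_poly_step.hyps(1), of "i - 1"] exp_poly_step.hyps
      by auto
  qed
  then have "d = (\<lambda>k. d 0 * exp_binom \<mu> 0 k)"
    by blast
  then have "d \<in> span exp_binoms"
    using exp_binom_in_span[OF exp_poly_step.hyps(1)] by metis
  moreover have "c = d + u" by (simp add: d_def fun_eq_iff)
  ultimately show ?case using u(1) by (metis span_add)
qed

section \<open>Recurrences given by polynomials\<close>

text \<open>The polynomial \<open>p\<close> in the shift operator, applied to a two-sided sequence \<open>c\<close>.\<close>

definition shift_poly :: "complex poly \<Rightarrow> (int \<Rightarrow> complex) \<Rightarrow> int \<Rightarrow> complex" where
  "shift_poly p c k = (\<Sum>j\<le>degree p. coeff p j * c (k + int j))"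

lemma shift_poly_bound:
  assumes "degree p \<le> n"
  shows "shift_poly p c k = (\<Sum>j\<le>n. coeff p j * c (k + int j))"
  unfolding shift_poly_def
  by (rule sum.mono_neutral_left) (use assms in \<open>auto simp: coeff_eq_0\<close>)

lemma shift_poly_linear_factor:
  "shift_poly ([:- \<mu>, 1:] * q) c k = shift_poly q (\<lambda>k. c (k + 1) - \<mu> * c k) k"
proof -
  define n where "n = degree q"
  have "shift_poly ([:- \<mu>, 1:] * q) c k
      = (\<Sum>j\<le>Suc n. coeff ([:- \<mu>, 1:] * q) j * c (k + int j))"
    by (rule shift_poly_bound) (use degree_mult_le[of "[:- \<mu>, 1:]" q] in \<open>simp add: n_def\<close>)
  also have "\<dots> = (\<Sum>j\<le>Suc n. coeff (pCons 0 q) j * c (k + int j)) - \<mu> * (\<Sum>j\<le>Suc n. coeff q j * c (k + int j))"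
    by (simp add: algebra_simps sum_distrib_left sum_subtractf del: sum.atMost_Suc)
  also have "(\<Sum>j\<le>Suc n. coeff (pCons 0 q) j * c (k + int j)) = (\<Sum>j\<le>n. coeff q j * c (k + 1 + int j))"
    by (subst sum.atMost_Suc_shift) (simp add: ac_simps)
  also have "(\<Sum>j\<le>Suc n. coeff q j * c (k + int j)) = (\<Sum>j\<le>n. coeff q j * c (k + int j))"
    by (simp add: n_def coeff_eq_0)
  finally show ?thesis
    by (simp add: shift_poly_def n_def algebra_simps sum_subtractf sum_distrib_left)
qed

text \<open>Any non-zero polynomial is allowed, also one with root \<open>0\<close>: on two-sided sequences the
  corresponding factor is a bijective shift.\<close>

lemma shift_poly_kernel:
  assumes "p \<noteq> 0" "\<And>k. shift_poly p c k = 0"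
  shows "c \<in> exp_poly"
  using assms
proof (induction "degree p" arbitrary: p c)
  case 0
  then obtain a where "p = [:a:]" "a \<noteq> 0"
    by (metis degree_eq_zeroE pCons_0_0)
  then have "c = (\<lambda>_. 0)" using 0 by (simp add: shift_poly_def fun_eq_iff)
  then show ?case by (simp add: exp_poly_zero)
next
  case (Suc n)
  then have "\<not> constant (poly p)"
    by (simp add: constant_degree)
  then obtain \<mu> where "poly p \<mu> = 0"
    using fundamental_theorem_of_algebra by blast
  then obtain q where p: "p = [:- \<mu>, 1:] * q"
    by (metis poly_eq_0_iff_dvd dvdE)
  have "q \<noteq> 0" using p Suc.prems(1) by auto
  then have "degree p = Suc (degree q)"
    unfolding p by (subst degree_mult_eq) auto
  then have "n = degree q" using Suc.hyps(2) by simp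
  moreover have "shift_poly q (\<lambda>k. c (k + 1) - \<mu> * c k) k = 0" for k
    using Suc.prems(2)[of k] unfolding p shift_poly_linear_factor .
  ultimately have mem: "(\<lambda>k. c (k + 1) - \<mu> * c k) \<in> exp_poly"
    using Suc.hyps(1)[of q] \<open>q \<noteq> 0\<close> by blast
  show ?case
  proof (cases "\<mu> = 0")
    case True
    then show ?thesis using exp_poly_shift[OF mem, of "-1"] by simp
  next
    case False
    then show ?thesis using mem by (rule exp_poly_step)
  qed
qed

section \<open>The graph of the reflection\<close>

lemma reflection_pair_in_span:
  assumes "(s, t) \<in> reflection_pairs"
  shows "(\<lambda>k. x * (s k * real (k choose i)), \<lambda>k. x * (t k * ((- real k) gchoose i)))
    \<in> span basis_reflection_pairs"
proof -
  have "(s * Lambda_seq i, t * (\<lambda>k. (- real k) gchoose i)) \<in> basis_reflection_pairs"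
    using assms unfolding basis_reflection_pairs_def by blast
  from span_scale[OF span_base[OF this], of x] show ?thesis
    by (simp only: scaleR_Pair scaleR_fun_def times_fun_def Lambda_seq_def real_scaleR_def)
qed

lemma reflection_pairsI:
  "x \<noteq> 0 \<Longrightarrow> (geom_seq x, \<lambda>k. x powi (- int k)) \<in> reflection_pairs"
  "0 < r \<Longrightarrow> 0 < \<theta> \<Longrightarrow> \<theta> < pi \<Longrightarrow>
    (cos_seq r \<theta>, \<lambda>k. r powi (- int k) * cos (- real k * \<theta>)) \<in> reflection_pairs"
  "0 < r \<Longrightarrow> 0 < \<theta> \<Longrightarrow> \<theta> < pi \<Longrightarrow>
    (sin_seq r \<theta>, \<lambda>k. r powi (- int k) * sin (- real k * \<theta>)) \<in> reflection_pairs"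
  unfolding reflection_pairs_def by blast+

text \<open>For non-real \<open>\<mu>\<close> the real part of \<open>\<alpha> \<mu>\<^sup>k\<close> is a combination of \<open>r\<^sup>k cos (k \<theta>)\<close> and \<open>r\<^sup>k sin (k \<theta>)\<close>, where
  \<open>\<mu> = r e\<^sup>i\<^sup>\<theta>\<close>.\<close>

lemma exp_poly_gives_pair:
  assumes "c \<in> exp_poly"
  shows "(\<lambda>k. Re (c (int k)), \<lambda>k. Re (c (- int k))) \<in> span basis_reflection_pairs"
proof -
  \<comment> \<open>The generators have \<open>\<theta>\<close> in \<open>]0, pi[\<close>, so non-real \<open>\<mu>\<close> is first taken in the upper half-plane.\<close>
  have upper: "(\<lambda>k. Re (\<alpha> * exp_binom \<mu> i (int k)), \<lambda>k. Re (\<alpha> * exp_binom \<mu> i (- int k)))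
      \<in> span basis_reflection_pairs" if "\<mu> \<noteq> 0" "Im \<mu> \<ge> 0" for \<alpha> \<mu> i
  proof (cases "Im \<mu> = 0")
    case True
    define x where "x = Re \<mu>"
    have \<mu>: "\<mu> = of_real x" using True by (simp add: x_def complex_eq_iff)
    have "Re (\<alpha> * exp_binom \<mu> i k) = Re \<alpha> * (x powi k * (of_int k gchoose i))" for k
      by (simp add: exp_binom_def \<mu> flip: of_real_power_int of_real_mult)
    then show ?thesis
      using reflection_pair_in_span[OF reflection_pairsI(1)[of x], of "Re \<alpha>" i] that \<mu>
      by (simp add: geom_seq_def binomial_gbinomial)
  next
    case False
    define r \<theta> where "r = cmod \<mu>" and "\<theta> = Arg \<mu>"
    have r: "r > 0" using that by (simp add: r_def)
    have \<mu>: "\<mu> = of_real r * cis \<theta>"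
      using that by (metis r_def \<theta>_def rcis_cmod_Arg rcis_def)
    have \<theta>: "0 < \<theta>" "\<theta> < pi"
      using Arg_lt_pi[of \<mu>] False that by (auto simp: \<theta>_def)
    have "Re (\<alpha> * exp_binom \<mu> i k)
        = Re \<alpha> * (r powi k * cos (of_int k * \<theta>) * (of_int k gchoose i))
        + - Im \<alpha> * (r powi k * sin (of_int k * \<theta>) * (of_int k gchoose i))" for k
    proof -
      have "\<mu> powi k = of_real (r powi k) * cis (of_int k * \<theta>)"
        by (simp add: \<mu> power_int_mult_distrib cis_power_int)
      then show ?thesis by (simp add: exp_binom_def algebra_simps del: of_real_power_int)
    qed
    with span_add[OF reflection_pair_in_span[OF reflection_pairsI(2)[OF r \<theta>], of "Re \<alpha>" i]
        reflection_pair_in_span[OF reflection_pairsI(3)[OF r \<theta>], of "- Im \<alpha>" i]]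
    show ?thesis
      by (simp add: cos_seq_def sin_seq_def binomial_gbinomial plus_fun_def)
  qed
  \<comment> \<open>Conjugating \<open>\<alpha>\<close> and \<open>\<mu>\<close> preserves the real part and exchanges the half-planes.\<close>
  have gen: "(\<lambda>k. Re (\<alpha> * exp_binom \<mu> i (int k)), \<lambda>k. Re (\<alpha> * exp_binom \<mu> i (- int k)))
      \<in> span basis_reflection_pairs" if "\<mu> \<noteq> 0" for \<alpha> \<mu> i
  proof (cases "Im \<mu> \<ge> 0")
    case False
    have "Re (\<alpha> * exp_binom \<mu> i k) = Re (cnj \<alpha> * exp_binom (cnj \<mu>) i k)" for k
    proof -
      have "cnj \<alpha> * exp_binom (cnj \<mu>) i k = cnj (\<alpha> * exp_binom \<mu> i k)"
        by (simp add: exp_binom_def)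
      then show ?thesis by (metis complex_cnj(1) cnj.simps(1))
    qed
    then show ?thesis using upper[of "cnj \<mu>" "cnj \<alpha>" i] that False by simp
  qed (use upper that in blast)
  have "c \<in> span exp_binoms" using assms by (rule exp_poly_in_span)
  then show ?thesis
  proof (induction rule: span_induct_alt)
    case base
    show ?case using span_zero[of basis_reflection_pairs] by (simp add: zero_fun_def zero_prod_def)
  next
    case (step t x y)
    then obtain \<alpha> \<mu> i where x: "x = (\<lambda>k. \<alpha> * exp_binom \<mu> i k)" "\<mu> \<noteq> 0"
      by (auto simp: exp_binoms_def)
    have "(\<lambda>k. Re (x (int k)), \<lambda>k. Re (x (- int k))) \<in> span basis_reflection_pairs"
      unfolding x(1) by (rule gen[OF x(2)])
    from span_add[OF span_scale[OF this, of t] step.IH] show ?case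
      by (simp add: scaleR_fun_def plus_fun_def)
  qed
qed

text \<open>Converse: each pair in the graph consists of the two halves of a single sequence, by the
  Euler formulas for cosine and sine.\<close>

lemma pair_extends_to_exp_poly:
  assumes "p \<in> span basis_reflection_pairs"
  shows "\<exists>c \<in> exp_poly. \<forall>k. c (int k) = of_real (fst p k) \<and> c (- int k) = of_real (snd p k)"
  using assms
proof (induction rule: span_induct_alt)
  case base
  show ?case by (intro bexI[of _ "\<lambda>_. 0"] exp_poly_zero) simp
next
  case (step t x y)
  obtain d where d: "d \<in> exp_poly" "\<And>k. d (int k) = of_real (fst y k)" "\<And>k. d (- int k) = of_real (snd y k)"
    using step by auto
  have "\<exists>c \<in> exp_poly. \<forall>k. c (int k) = of_real (fst x k) \<and> c (- int k) = of_real (snd x k)"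
  proof -
    obtain s u i where x: "x = (s * Lambda_seq i, u * (\<lambda>k. (- real k) gchoose i))"
      and su: "(s, u) \<in> reflection_pairs"
      using step by (auto simp: basis_reflection_pairs_def)
    have trig: "(\<lambda>k. \<alpha> * exp_binom (of_real r * cis \<theta>) i k + \<beta> * exp_binom (of_real r * cis (- \<theta>)) i k) \<in> exp_poly"
      if "r > 0" for \<alpha> \<beta> r \<theta>
      using that by (intro exp_poly_add exp_poly_scale exp_binom_in_exp_poly) auto
    have pw: "exp_binom (of_real r * cis \<theta>) i k = of_real (r powi k) * cis (of_int k * \<theta>) * of_real (of_int k gchoose i)"
      for r \<theta> k
      by (simp add: exp_binom_def power_int_mult_distrib cis_power_int)
    from su consider
      (geom) z where "z \<noteq> 0" "s = geom_seq z" "u = (\<lambda>k. z powi (- int k))"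
    | (cos) r \<theta> where "0 < r" "s = cos_seq r \<theta>" "u = (\<lambda>k. r powi (- int k) * cos (- real k * \<theta>))"
    | (sin) r \<theta> where "0 < r" "s = sin_seq r \<theta>" "u = (\<lambda>k. r powi (- int k) * sin (- real k * \<theta>))"
      unfolding reflection_pairs_def by blast
    then show ?thesis
    proof cases
      case geom
      show ?thesis
        by (rule bexI[of _ "exp_binom (of_real z) i"], unfold x)
          (use geom in \<open>auto simp: exp_binom_def geom_seq_def Lambda_seq_def binomial_gbinomial
            intro!: exp_binom_in_exp_poly simp flip: of_real_power_int\<close>)
    next
      case cos
      show ?thesis
        by (rule bexI[OF _ trig[of r "1/2" \<theta> "1/2"]], unfold x pw)
          (use cos in \<open>auto simp: cos_seq_def Lambda_seq_def binomial_gbinomial complex_eq_iff field_simps\<close>)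
    next
      case sin
      show ?thesis
        by (rule bexI[OF _ trig[of r "-\<i>/2" \<theta> "\<i>/2"]], unfold x pw)
          (use sin in \<open>auto simp: sin_seq_def Lambda_seq_def binomial_gbinomial complex_eq_iff field_simps\<close>)
    qed
  qed
  then obtain c where c: "c \<in> exp_poly" "\<And>k. c (int k) = of_real (fst x k)" "\<And>k. c (- int k) = of_real (snd x k)"
    by auto
  show ?case
    by (rule bexI[OF _ exp_poly_add[OF exp_poly_scale[OF c(1), of "of_real t"] d(1)]])
      (simp add: c d scaleR_fun_def)
qed

text \<open>For \<open>a = 0\<close> the second conclusion says that the graph is single-valued; the first one gives
  the uniqueness of the geometric part.\<close>

lemma reflection_of_eventually_zero:
  assumes "(a, b) \<in> span basis_reflection_pairs" "\<And>k. k \<ge> K \<Longrightarrow> a k = 0"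
  shows "a = 0" "b = 0"
proof -
  obtain c where c: "c \<in> exp_poly" "\<And>k. c (int k) = of_real (a k)" "\<And>k. c (- int k) = of_real (b k)"
    using pair_extends_to_exp_poly[OF assms(1)] by auto
  have "c k = 0" for k
  proof (rule exp_poly_eventually_zero[OF c(1), of "int K"])
    fix k assume "int K \<le> k"
    then show "c k = 0" using c(2)[of "nat k"] assms(2)[of "nat k"] by auto
  qed
  then show "a = 0" "b = 0" using c(2,3) by (auto simp: fun_eq_iff)
qed

lemma plug_neg_eq:
  assumes "(a, b) \<in> span basis_reflection_pairs"
  shows "plug_neg a = b"
  unfolding plug_neg_def
proof (rule the_equality)
  show "(a, b) \<in> span basis_reflection_pairs" by (rule assms)
next
  fix b' assume "(a, b') \<in> span basis_reflection_pairs"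
  from span_diff[OF this assms] have "(0, b' - b) \<in> span basis_reflection_pairs" by simp
  then have "b' - b = 0" by (rule reflection_of_eventually_zero(2)[of _ _ 0]) simp
  then show "b' = b" by simp
qed

section \<open>Powers of a matrix and annihilating polynomials\<close>

lemma mat_power_0 [simp]: "mat_power A 0 = mat 1"
  by (simp add: mat_power_def)

lemma mat_power_Suc: "mat_power A (Suc k) = A ** mat_power A k"
  by (simp add: mat_power_def)

lemma mat_power_add: "mat_power A (m + n) = mat_power A m ** mat_power A n"
  by (induction m) (simp_all add: mat_power_Suc matrix_mul_assoc matrix_mul_lid)

lemma mat_power_commutes:
  assumes "A ** B = B ** A"
  shows "mat_power A k ** B = B ** mat_power A k"
proof (induction k)
  case (Suc k)
  then show ?case by (metis assms mat_power_Suc matrix_mul_assoc)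
qed (simp add: matrix_mul_lid matrix_mul_rid)

lemma mat_power_Suc2: "mat_power A (Suc k) = mat_power A k ** A"
  by (simp add: mat_power_Suc mat_power_commutes)

lemma mat_power_mult_scaleR:
  "mat_power A k ** (c *\<^sub>R mat_power A i) = c *\<^sub>R mat_power A (k + i)"
  "A ** (c *\<^sub>R mat_power A i) = c *\<^sub>R mat_power A (Suc i)"
  "(c *\<^sub>R mat_power A i) ** A = c *\<^sub>R mat_power A (Suc i)"
  by (simp_all add: mat_power_add mat_power_Suc matrix_scalar_ac flip: scalar_matrix_assoc)
    (simp add: mat_power_commutes)

lemma mat_power_mult:
  assumes "A ** B = B ** A"
  shows "mat_power (A ** B) k = mat_power A k ** mat_power B k"
proof (induction k)
  case (Suc k)
  then show ?case
    by (metis assms mat_power_Suc mat_power_commutes matrix_mul_assoc)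
qed (simp add: matrix_mul_lid)

lemma mat_power_idempotent:
  assumes "E ** E = E" "k > 0"
  shows "mat_power E k = E"
  using assms(2,1)
  by (induction k rule: nat_induct_non_zero) (simp_all add: mat_power_Suc matrix_mul_rid)

lemma matrix_mul_sum_right:
  fixes A :: "real^'n^'n" and f :: "'a \<Rightarrow> real^'n^'n"
  shows "A ** (\<Sum>j\<in>F. f j) = (\<Sum>j\<in>F. A ** f j)"
  by (induction F rule: infinite_finite_induct) (simp_all add: matrix_add_ldistrib)

lemma matrix_mul_add_left:
  fixes A :: "real^'n^'n"
  shows "(B + C) ** A = B ** A + C ** A"
  by (vector matrix_matrix_mult_def sum.distrib[symmetric] field_simps)

lemma matrix_mul_sum_left:
  fixes A :: "real^'n^'n" and f :: "'a \<Rightarrow> real^'n^'n"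
  shows "(\<Sum>j\<in>F. f j) ** A = (\<Sum>j\<in>F. f j ** A)"
  by (induction F rule: infinite_finite_induct) (simp_all add: matrix_mul_add_left)

lemma annihilating_polynomial_exists:
  fixes A :: "real^'n^'n"
  obtains N p where "(\<Sum>j\<le>N. p j *\<^sub>R mat_power A j) = 0" "\<exists>j\<le>N. p j \<noteq> (0::real)"
proof (cases "inj (mat_power A)")
  case True
  define N where "N = DIM(real^'n^'n)"
  let ?S = "mat_power A ` {..N}"
  have inj: "inj_on (mat_power A) {..N}" using True by (rule inj_on_subset) simp
  have "card ?S = Suc N" using inj by (simp add: card_image)
  then have "dependent ?S" by (intro dependent_biggerset) (simp add: N_def)
  then obtain u where "\<exists>v\<in>?S. u v \<noteq> 0" "(\<Sum>v\<in>?S. u v *\<^sub>R v) = 0"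
    by (auto simp: dependent_finite)
  then show ?thesis
    using inj by (intro that[where N=N and p="\<lambda>j. u (mat_power A j)"]) (auto simp: sum.reindex)
next
  case False
  then obtain i j where ij: "i < j" "mat_power A i = mat_power A j"
    by (metis injI linorder_neqE_nat)
  let ?p = "\<lambda>l. if l = i then 1 else if l = j then - 1 else (0::real)"
  have "(\<Sum>l\<le>j. ?p l *\<^sub>R mat_power A l)
      = (\<Sum>l\<le>j. (if l = i then mat_power A i else 0) - (if l = j then mat_power A j else 0))"
    by (rule sum.cong) (use ij in auto)
  also have "\<dots> = 0" using ij by (simp add: sum_subtractf)
  finally show ?thesis using ij by (intro that[where N=j and p="?p"]) auto
qed

text \<open>An annihilating polynomial \<open>p\<close> of \<open>A\<close>, divided by its lowest non-zero coefficient, expresses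
  \<open>A\<^sup>m\<close> as \<open>A\<^sup>m\<^sup>+\<^sup>1 S\<close> with \<open>S\<close> a polynomial in \<open>A\<close>.\<close>

lemma power_stabilizes:
  fixes A :: "real^'n^'n"
  obtains m S where "A ** S = S ** A" "mat_power A m = mat_power A (Suc m) ** S"
proof -
  obtain N p where p: "(\<Sum>j\<le>N. p j *\<^sub>R mat_power A j) = 0" "\<exists>j\<le>N. p j \<noteq> (0::real)"
    by (rule annihilating_polynomial_exists)
  define m where "m = (LEAST j. p j \<noteq> 0)"
  obtain j0 where j0: "j0 \<le> N" "p j0 \<noteq> 0" using p(2) by blast
  have "p m \<noteq> 0" unfolding m_def by (rule LeastI[of _ j0]) fact
  moreover have "m \<le> j0" unfolding m_def by (rule Least_le) fact
  moreover have "p j = 0" if "j < m" for j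
    using not_less_Least[OF that[unfolded m_def]] by simp
  ultimately have m: "p m \<noteq> 0" "m \<le> N" "\<And>j. j < m \<Longrightarrow> p j = 0"
    using j0(1) by (blast intro: order_trans)+
  define S where "S = (\<Sum>j\<in>{Suc m..N}. (- p j / p m) *\<^sub>R mat_power A (j - Suc m))"
  have "A ** S = S ** A"
    unfolding S_def matrix_mul_sum_right matrix_mul_sum_left
    by (simp only: mat_power_mult_scaleR)
  moreover have "mat_power A m = mat_power A (Suc m) ** S"
  proof -
    have "(\<Sum>j\<le>N. p j *\<^sub>R mat_power A j) = (\<Sum>j\<in>{m..N}. p j *\<^sub>R mat_power A j)"
      by (rule sum.mono_neutral_right) (use m in auto)
    also have "\<dots> = p m *\<^sub>R mat_power A m + (\<Sum>j\<in>{Suc m..N}. p j *\<^sub>R mat_power A j)"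
      by (rule sum.atLeast_Suc_atMost[OF m(2)])
    finally have eq: "p m *\<^sub>R mat_power A m = - (\<Sum>j\<in>{Suc m..N}. p j *\<^sub>R mat_power A j)"
      using p(1) by (simp add: eq_neg_iff_add_eq_0)
    have "mat_power A m = (1 / p m) *\<^sub>R (p m *\<^sub>R mat_power A m)" using m(1) by simp
    also have "\<dots> = (- (1 / p m)) *\<^sub>R (\<Sum>j\<in>{Suc m..N}. p j *\<^sub>R mat_power A j)"
      unfolding eq by simp
    also have "\<dots> = mat_power A (Suc m) ** S"
      unfolding S_def matrix_mul_sum_right scaleR_sum_right
      by (rule sum.cong) (simp_all add: mat_power_mult_scaleR del: scaleR_minus_left)
    finally show ?thesis .
  qed
  ultimately show ?thesis by (rule that)
qed

section \<open>Drazin inverse and spectral projection at zero\<close>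

text \<open>With \<open>A\<^sup>m = A\<^sup>m\<^sup>+\<^sup>1 S\<close>, the matrix \<open>A\<^sup>m S\<^sup>m\<^sup>+\<^sup>1\<close> is a Drazin inverse of \<open>A\<close>.\<close>

lemma drazin_inverse_exists:
  fixes A :: "real^'n^'n"
  shows "\<exists>B. is_drazin_inverse A B"
proof -
  obtain m S where AS: "A ** S = S ** A" and S: "mat_power A m = mat_power A (Suc m) ** S"
    by (rule power_stabilizes)
  have stable: "mat_power A m = mat_power A (m + j) ** mat_power S j" for j
  proof (induction j)
    case (Suc j)
    have "mat_power A (m + Suc j) ** mat_power S (Suc j)
        = mat_power A j ** (mat_power A (Suc m) ** S) ** mat_power S j"
      by (simp add: mat_power_Suc[of S] matrix_mul_assoc flip: mat_power_add) (simp add: ac_simps)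
    also have "\<dots> = mat_power A (m + j) ** mat_power S j"
      by (simp add: ac_simps flip: S mat_power_add)
    finally show ?case using Suc by simp
  qed (simp add: matrix_mul_rid)
  have pS: "mat_power A i ** mat_power S j = mat_power S j ** mat_power A i" for i j
    by (metis AS mat_power_commutes)
  define B where "B = mat_power A m ** mat_power S (Suc m)"
  have AB: "A ** B = B ** A"
    unfolding B_def by (metis AS mat_power_commutes matrix_mul_assoc)
  have ABm: "A ** B = mat_power A m ** mat_power S m"
  proof -
    have "A ** B = mat_power A (Suc m) ** S ** mat_power S m"
      by (simp add: B_def mat_power_Suc matrix_mul_assoc)
    then show ?thesis by (simp flip: S)
  qed
  have "mat_power A m ** B ** A = mat_power A (m + m) ** mat_power S m"
    unfolding matrix_mul_assoc[symmetric] AB[symmetric] ABm mat_power_add ..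
  then have "mat_power A m ** B ** A = mat_power A m"
    by (simp flip: stable)
  moreover have "B ** A ** B = B"
  proof -
    have "B ** A ** B = (mat_power A m ** mat_power S m) ** (mat_power A m ** mat_power S (Suc m))"
      by (simp add: ABm flip: AB) (simp add: B_def)
    also have "\<dots> = (mat_power A (m + m) ** mat_power S m) ** mat_power S (Suc m)"
      by (metis mat_power_add pS matrix_mul_assoc)
    finally show ?thesis by (simp add: B_def flip: stable)
  qed
  ultimately show ?thesis using AB unfolding is_drazin_inverse_def by blast
qed

lemma drazin_projection:
  fixes A :: "real^'n^'n"
  assumes "is_drazin_inverse A B"
  shows "A ** B = B ** A" "B ** A ** B = B" "(A ** B) ** (A ** B) = A ** B"
    "\<exists>k. mat_power A k ** (A ** B) = mat_power A k"
  using assms unfolding is_drazin_inverse_def by (metis matrix_mul_assoc)+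

lemma drazin_eventually_stable:
  fixes A :: "real^'n^'n"
  assumes "is_drazin_inverse A B"
  shows "\<exists>K. \<forall>k\<ge>K. mat_power A k ** (A ** B) = mat_power A k"
proof -
  obtain K where K: "mat_power A K ** (A ** B) = mat_power A K"
    using drazin_projection(4)[OF assms] by blast
  have "mat_power A k ** (A ** B) = mat_power A k" if "k \<ge> K" for k
  proof -
    have "mat_power A k = mat_power A (k - K) ** mat_power A K"
      using that by (simp flip: mat_power_add)
    then show ?thesis using K by (metis matrix_mul_assoc)
  qed
  then show ?thesis by blast
qed

lemma drazin_power_projection:
  fixes A :: "real^'n^'n"
  assumes "is_drazin_inverse A B" "k > 0"
  shows "mat_power A k ** mat_power B k = A ** B" "mat_power B k ** mat_power A k = A ** B"
proof -
  note D = drazin_projection[OF assms(1)]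
  show "mat_power A k ** mat_power B k = A ** B"
    using mat_power_mult[OF D(1), of k] mat_power_idempotent[OF D(3) assms(2)] by simp
  then show "mat_power B k ** mat_power A k = A ** B"
    by (metis D(1) mat_power_commutes)
qed

lemma drazin_inverse_unique:
  fixes A :: "real^'n^'n"
  assumes B: "is_drazin_inverse A B" and C: "is_drazin_inverse A C"
  shows "B = C"
proof -
  \<comment> \<open>The idempotents of any two Drazin inverses absorb each other, hence they are equal.\<close>
  have absorb: "(A ** Y) ** (A ** X) = A ** X \<and> (A ** X) ** (A ** Y) = A ** X"
    if X: "is_drazin_inverse A X" and Y: "is_drazin_inverse A Y" for X Y
  proof -
    note DX = drazin_projection[OF X] and DY = drazin_projection[OF Y]
    obtain k where "mat_power A k ** (A ** Y) = mat_power A k" using DY(4) by blast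
    then have k: "mat_power A (Suc k) ** (A ** Y) = mat_power A (Suc k)"
      by (metis mat_power_Suc matrix_mul_assoc)
    have comm: "mat_power A (Suc k) ** (A ** Y) = (A ** Y) ** mat_power A (Suc k)"
      by (rule mat_power_commutes) (metis DY(1) matrix_mul_assoc)
    show ?thesis
      using k comm drazin_power_projection[OF X, of "Suc k"] by (metis matrix_mul_assoc zero_less_Suc)
  qed
  have eq: "A ** B = A ** C"
    using absorb[OF B C] absorb[OF C B] by metis
  show ?thesis
    using eq drazin_projection[OF B] drazin_projection[OF C] by (metis matrix_mul_assoc)
qed

lemma is_drazin_inverse_drazin_inverse:
  fixes A :: "real^'n^'n"
  shows "is_drazin_inverse A (drazin_inverse A)"
  unfolding drazin_inverse_def
  using drazin_inverse_exists drazin_inverse_unique by (metis theI')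

text \<open>The kernels of the powers of \<open>A\<close> increase and are constant once two consecutive ones agree.
  If that did not happen within the first \<open>CARD('n) + 1\<close> steps, the dimension would exceed
  \<open>CARD('n)\<close>.\<close>

lemma kernel_mat_power_bound:
  fixes A :: "real^'n^'n"
  assumes "mat_power A k *v y = 0"
  shows "mat_power A CARD('n) *v y = 0"
proof (rule ccontr)
  assume y: "mat_power A CARD('n) *v y \<noteq> 0"
  define K where "K i = {x. mat_power A i *v x = 0}" for i
  have sub: "subspace (K i)" for i
    unfolding K_def by (auto simp: subspace_def matrix_vector_right_distrib matrix_vector_mult_scaleR)
  have mono: "K i \<subseteq> K (i + d)" for i d
    by (auto simp: K_def mat_power_add add.commute[of i] simp flip: matrix_vector_mul_assoc)
  have next_iff: "x \<in> K (Suc i) \<longleftrightarrow> A *v x \<in> K i" for x i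
    by (simp add: K_def mat_power_Suc2 matrix_vector_mul_assoc)
  have stable: "K (i + d) = K i" if "K (Suc i) = K i" for i d
  proof (induction d)
    case (Suc d)
    have "K (Suc (i + d)) = K (Suc i)"
      using Suc next_iff by blast
    then show ?case using that by simp
  qed simp
  have strict: "K i \<subset> K (Suc i)" if "i \<le> CARD('n)" for i
  proof -
    have "y \<notin> K i" using mono[of i "CARD('n) - i"] that y by (auto simp: K_def)
    moreover have "y \<in> K (i + k)" using mono[of k i] assms by (auto simp: K_def add.commute)
    ultimately show ?thesis using stable[of i k] mono[of i 1] by auto
  qed
  have "i \<le> dim (K i)" if "i \<le> Suc CARD('n)" for i
    using that
  proof (induction i)
    case (Suc i)
    have "dim (K i) < dim (K (Suc i))"
      by (rule dim_psubset) (use strict[of i] sub Suc.prems in \<open>simp add: span_eq_iff[THEN iffD2]\<close>)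
    then show ?case using Suc by simp
  qed simp
  from this[of "Suc CARD('n)"] dim_subset_UNIV[of "K (Suc CARD('n))"] show False by simp
qed

lemma spectral_proj0_eq:
  fixes A :: "real^'n^'n"
  assumes "is_drazin_inverse A B"
  shows "spectral_proj0 A = mat 1 - A ** B"
proof -
  note D = drazin_projection[OF assms]
  define E where "E = A ** B"
  let ?q = "CARD('n)"
  have E: "E ** E = E" using D(3) by (simp add: E_def)
  have q: "?q > 0" by simp
  have AE: "mat_power A ?q ** E = mat_power A ?q"
  proof -
    obtain k where k: "mat_power A k ** E = mat_power A k" using D(4) by (auto simp: E_def)
    have "mat_power A ?q *v (x - E *v x) = 0" for x
      by (rule kernel_mat_power_bound[of _ k])
        (simp add: matrix_vector_mult_diff_distrib matrix_vector_mul_assoc k)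
    then show ?thesis
      by (simp add: matrix_eq matrix_vector_mult_diff_distrib flip: matrix_vector_mul_assoc)
  qed
  have EA: "E ** mat_power A ?q = mat_power A ?q"
    using AE mat_power_commutes[of A E ?q] D(1) by (metis E_def matrix_mul_assoc)
  have Ex: "(mat 1 - E) *v x = x - E *v x" for x
    by (simp add: matrix_vector_mult_diff_rdistrib)
  have range: "range ((*v) (mat 1 - E)) = {x. mat_power A ?q *v x = 0}"
  proof (intro equalityI subsetI)
    fix x assume "x \<in> {x. mat_power A ?q *v x = 0}"
    then have "mat_power B ?q *v (mat_power A ?q *v x) = 0" by simp
    then have "E *v x = 0"
      by (simp add: matrix_vector_mul_assoc drazin_power_projection(2)[OF assms q] E_def)
    then have "x = (mat 1 - E) *v x" by (simp add: Ex)
    then show "x \<in> range ((*v) (mat 1 - E))" by blast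
  qed (auto simp: Ex matrix_vector_mult_diff_distrib matrix_vector_mul_assoc AE)
  have kernel: "{x. (mat 1 - E) *v x = 0} = range ((*v) (mat_power A ?q))"
  proof (intro equalityI subsetI)
    fix x assume "x \<in> {x. (mat 1 - E) *v x = 0}"
    then have "x = E *v x" by (simp add: Ex)
    also have "\<dots> = mat_power A ?q *v (mat_power B ?q *v x)"
      by (simp add: matrix_vector_mul_assoc drazin_power_projection(1)[OF assms q] E_def)
    finally show "x \<in> range ((*v) (mat_power A ?q))" by blast
  qed (auto simp: Ex matrix_vector_mul_assoc EA)
  have idem: "(mat 1 - E) ** (mat 1 - E) = mat 1 - E"
    by (simp add: matrix_eq Ex matrix_vector_mult_diff_distrib matrix_vector_mul_assoc E flip: matrix_vector_mul_assoc)
      (simp add: matrix_vector_mul_assoc E)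
  \<comment> \<open>An idempotent matrix is determined by its range and kernel.\<close>
  have unique: "P = Q" if PQ: "P ** P = P" "Q ** Q = Q" "range ((*v) P) = range ((*v) Q)"
    "{x. P *v x = 0} = {x. Q *v x = 0}" for P Q :: "real^'n^'n"
  proof -
    have "P *v x = Q *v x" for x
    proof -
      have "P *v (x - P *v x) = 0"
        by (simp add: matrix_vector_mult_diff_distrib matrix_vector_mul_assoc PQ)
      then have "Q *v (x - P *v x) = 0" using PQ(4) by blast
      then have "Q *v x = Q *v (P *v x)" by (simp add: matrix_vector_mult_diff_distrib)
      moreover obtain z where "P *v x = Q *v z" using PQ(3) by blast
      ultimately show ?thesis by (simp add: matrix_vector_mul_assoc PQ)
    qed
    then show ?thesis by (simp add: matrix_eq)
  qed
  show ?thesis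
    unfolding spectral_proj0_def E_def[symmetric]
  proof (rule the_equality)
    show "(mat 1 - E) ** (mat 1 - E) = mat 1 - E \<and>
        range ((*v) (mat 1 - E)) = {x. mat_power A ?q *v x = 0} \<and>
        {x. (mat 1 - E) *v x = 0} = range ((*v) (mat_power A ?q))"
      by (intro conjI idem range kernel)
  next
    fix P :: "real^'n^'n"
    assume P: "P ** P = P \<and> range ((*v) P) = {x. mat_power A ?q *v x = 0} \<and>
        {x. P *v x = 0} = range ((*v) (mat_power A ?q))"
    show "P = mat 1 - E"
      by (rule unique[OF P[THEN conjunct1] idem trans[OF P[THEN conjunct2, THEN conjunct1] range[symmetric]]
        trans[OF P[THEN conjunct2, THEN conjunct2] kernel[symmetric]]])
  qed
qed

section \<open>Geometric sums and their reflections\<close>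

lemma generators_reflect:
  "s \<in> S_tilde \<union> S_plus1 \<union> S_plus2 \<longleftrightarrow> (\<exists>t. (s, t) \<in> reflection_pairs)"
  unfolding S_tilde_def S_plus1_def S_plus2_def reflection_pairs_def by blast

lemma geometric_term_reflects:
  assumes "f \<in> span (S_tilde \<union> S_plus1 \<union> S_plus2)"
  shows "\<exists>b. (\<lambda>k. Lambda_seq i k * f k, b) \<in> span basis_reflection_pairs"
  using assms
proof (induction rule: span_induct_alt)
  case base
  have "(\<lambda>k. Lambda_seq i k * 0 k, 0) = (0 :: (nat \<Rightarrow> real) \<times> (nat \<Rightarrow> real))"
    by (simp add: zero_prod_def fun_eq_iff)
  then show ?case by (metis span_zero)
next
  case (step x s f)
  then obtain b where b: "(\<lambda>k. Lambda_seq i k * f k, b) \<in> span basis_reflection_pairs"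
    by blast
  obtain t where "(s, t) \<in> reflection_pairs" using step.hyps generators_reflect by blast
  from span_add[OF reflection_pair_in_span[OF this, of x i] b]
  have "((\<lambda>k. x * (s k * real (k choose i))) + (\<lambda>k. Lambda_seq i k * f k),
      (\<lambda>k. x * (t k * (- real k gchoose i))) + b) \<in> span basis_reflection_pairs"
    by (simp only: add_Pair)
  moreover have "(\<lambda>k. x * (s k * real (k choose i))) + (\<lambda>k. Lambda_seq i k * f k)
      = (\<lambda>k. Lambda_seq i k * (x *\<^sub>R s + f) k)"
    by (simp add: fun_eq_iff scaleR_fun_def Lambda_seq_def algebra_simps)
  ultimately show ?case by auto
qed

lemma geometric_sum_reflects:
  assumes "\<forall>i\<le>l. f i \<in> span (S_tilde \<union> S_plus1 \<union> S_plus2)"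
  shows "\<exists>b. (\<lambda>k. \<Sum>i\<le>l. Lambda_seq i k * f i k, b) \<in> span basis_reflection_pairs"
  using assms
proof (induction l)
  case 0
  then show ?case using geometric_term_reflects[of "f 0" 0] by simp
next
  case (Suc l)
  then obtain b where b: "(\<lambda>k. \<Sum>i\<le>l. Lambda_seq i k * f i k, b) \<in> span basis_reflection_pairs"
    by auto
  obtain b' where "(\<lambda>k. Lambda_seq (Suc l) k * f (Suc l) k, b') \<in> span basis_reflection_pairs"
    using geometric_term_reflects Suc.prems by blast
  from span_add[OF b this]
  have "(\<lambda>k. \<Sum>i\<le>Suc l. Lambda_seq i k * f i k, b + b') \<in> span basis_reflection_pairs"
    by (simp add: plus_fun_def)
  then show ?case by blast
qed

text \<open>The first half of a pair in the graph, grouped by binomial index. The number of terms may be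
  enlarged at will, so that one length serves all entries of a matrix.\<close>

lemma reflected_sequence_grouping:
  assumes "p \<in> span basis_reflection_pairs"
  shows "\<exists>f l. (\<forall>i. f i \<in> span (S_tilde \<union> S_plus1 \<union> S_plus2)) \<and>
    (\<forall>m\<ge>l. \<forall>k. fst p k = (\<Sum>i\<le>m. Lambda_seq i k * f i k))"
  using assms
proof (induction rule: span_induct_alt)
  case base
  show ?case by (intro exI[of _ "\<lambda>_. 0"] exI[of _ 0] conjI allI impI span_zero) simp
next
  case (step x q p)
  then obtain f l where f: "\<And>i. f i \<in> span (S_tilde \<union> S_plus1 \<union> S_plus2)"
    "\<And>m k. m \<ge> l \<Longrightarrow> fst p k = (\<Sum>i\<le>m. Lambda_seq i k * f i k)"
    by blast
  obtain s t j where q: "q = (s * Lambda_seq j, t * (\<lambda>k. (- real k) gchoose j))"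
    and st: "(s, t) \<in> reflection_pairs"
    using step.hyps by (auto simp: basis_reflection_pairs_def)
  have s: "s \<in> span (S_tilde \<union> S_plus1 \<union> S_plus2)"
    using st generators_reflect by (blast intro: span_base)
  define g where "g i = (if i = j then x *\<^sub>R s else 0) + f i" for i
  have "g i \<in> span (S_tilde \<union> S_plus1 \<union> S_plus2)" for i
    unfolding g_def by (intro span_add f(1)) (simp add: span_scale s span_zero)
  moreover have "fst (x *\<^sub>R q + p) k = (\<Sum>i\<le>m. Lambda_seq i k * g i k)" if "m \<ge> max l j" for m k
  proof -
    have "(\<Sum>i\<le>m. Lambda_seq i k * g i k)
        = (\<Sum>i\<le>m. if i = j then Lambda_seq j k * (x * s k) else 0) + (\<Sum>i\<le>m. Lambda_seq i k * f i k)"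
      unfolding sum.distrib[symmetric]
      by (rule sum.cong) (simp_all add: g_def scaleR_fun_def algebra_simps)
    then show ?thesis using that f(2)[of m k] by (simp add: q scaleR_fun_def)
  qed
  ultimately show ?case by blast
qed

lemma finite_support_in_span:
  assumes "\<And>k. k \<ge> K \<Longrightarrow> f k = 0"
  shows "f \<in> span S_circ"
proof -
  have sum_apply: "(\<Sum>i\<in>F. g i) k = (\<Sum>i\<in>F. g i k)"
    for F and g :: "nat \<Rightarrow> nat \<Rightarrow> real" and k
    by (induction F rule: infinite_finite_induct) auto
  have "f = (\<Sum>i<K. f i *\<^sub>R delta_seq i)"
  proof
    fix k
    show "f k = (\<Sum>i<K. f i *\<^sub>R delta_seq i) k"
      using assms[of k] by (simp add: sum_apply scaleR_fun_def delta_seq_def if_distrib cong: if_cong)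
  qed
  also have "\<dots> \<in> span S_circ"
    by (intro span_sum span_scale span_base) (simp add: S_circ_def)
  finally show ?thesis .
qed

lemma span_finite_support:
  assumes "f \<in> span S_circ"
  shows "\<exists>K. \<forall>k\<ge>K. f k = 0"
  using assms
proof (induction rule: span_induct_alt)
  case (step x s f)
  then obtain K i where "\<forall>k\<ge>K. f k = 0" "s = delta_seq i" by (auto simp: S_circ_def)
  then show ?case
    by (intro exI[of _ "max K (Suc i)"]) (auto simp: scaleR_fun_def delta_seq_def)
qed simp

section \<open>The two-sided powers of a matrix\<close>

text \<open>Intended for a Drazin inverse \<open>B\<close> of \<open>A\<close>: the powers of the invertible part of \<open>A\<close>, extended
  by zero to the kernel of \<open>A ** B\<close>. At \<open>0\<close> the value is the projection \<open>A ** B\<close>, not the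
  identity, whence the correction by the spectral projection at index \<open>0\<close>.\<close>

definition two_sided_powers :: "real^'n^'n \<Rightarrow> real^'n^'n \<Rightarrow> int \<Rightarrow> real^'n^'n" where
  "two_sided_powers A B z = (if z \<ge> 0 then mat_power A (nat z) ** (A ** B) else mat_power B (nat (- z)))"

lemma two_sided_powers_step:
  fixes A :: "real^'n^'n"
  assumes "is_drazin_inverse A B"
  shows "two_sided_powers A B (z + 1) = A ** two_sided_powers A B z"
proof (cases "z \<ge> 0")
  case True
  then have "nat (z + 1) = Suc (nat z)" by simp
  then show ?thesis using True by (simp add: two_sided_powers_def mat_power_Suc matrix_mul_assoc)
next
  case False
  note D = drazin_projection[OF assms]
  show ?thesis
  proof (cases "z = - 1")
    case True
    then show ?thesis by (simp add: two_sided_powers_def mat_power_Suc)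
  next
    case z: False
    \<comment> \<open>Here \<open>z \<le> - 2\<close>, and both exponents \<open>- z\<close> and \<open>- (z + 1)\<close> are positive.\<close>
    define m where "m = nat (- z - 2)"
    have "nat (- z) = Suc (Suc m)" "nat (- (z + 1)) = Suc m" "\<not> z + 1 \<ge> 0"
      using False z by (auto simp: m_def)
    moreover have "B ** mat_power B m = A ** (B ** (B ** mat_power B m))"
      using D(1,2) by (metis matrix_mul_assoc)
    ultimately show ?thesis using False by (simp add: two_sided_powers_def mat_power_Suc)
  qed
qed

lemma two_sided_powers_shift:
  fixes A :: "real^'n^'n"
  assumes "is_drazin_inverse A B"
  shows "two_sided_powers A B (z + int j) = mat_power A j ** two_sided_powers A B z"
proof (induction j)
  case (Suc j)
  have "two_sided_powers A B (z + int (Suc j)) = two_sided_powers A B ((z + int j) + 1)"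
    by (simp add: ac_simps)
  also have "\<dots> = mat_power A (Suc j) ** two_sided_powers A B z"
    by (simp only: two_sided_powers_step[OF assms] Suc mat_power_Suc matrix_mul_assoc)
  finally show ?case .
qed simp

lemma two_sided_powers_in_exp_poly:
  fixes A :: "real^'n^'n"
  assumes "is_drazin_inverse A B"
  shows "(\<lambda>z. complex_of_real (two_sided_powers A B z $ a $ b)) \<in> exp_poly"
proof -
  obtain N p where p: "(\<Sum>j\<le>N. p j *\<^sub>R mat_power A j) = 0" "\<exists>j\<le>N. p j \<noteq> (0::real)"
    by (rule annihilating_polynomial_exists)
  define P where "P = (\<Sum>j\<le>N. monom (complex_of_real (p j)) j)"
  have coeff: "coeff P j = (if j \<le> N then of_real (p j) else 0)" for j
    by (simp add: P_def coeff_sum)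
  have "P \<noteq> 0"
  proof
    assume "P = 0"
    obtain j where "j \<le> N" "p j \<noteq> 0" using p(2) by blast
    then show False using coeff[of j] \<open>P = 0\<close> by simp
  qed
  moreover have "shift_poly P (\<lambda>z. of_real (two_sided_powers A B z $ a $ b)) k = 0" for k
  proof -
    have "degree P \<le> N" by (rule degree_le) (simp add: coeff)
    then have "shift_poly P (\<lambda>z. of_real (two_sided_powers A B z $ a $ b)) k
        = of_real (\<Sum>j\<le>N. p j * (two_sided_powers A B (k + int j) $ a $ b))"
      by (simp add: shift_poly_bound coeff)
    also have "(\<Sum>j\<le>N. p j * (two_sided_powers A B (k + int j) $ a $ b))
        = ((\<Sum>j\<le>N. p j *\<^sub>R mat_power A j) ** two_sided_powers A B k) $ a $ b"
      by (simp add: matrix_mul_sum_left two_sided_powers_shift[OF assms] flip: scalar_matrix_assoc)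
    finally show ?thesis by (simp add: p(1))
  qed
  ultimately show ?thesis by (rule shift_poly_kernel)
qed

lemma matrix_powers_reflect:
  fixes A :: "real^'n^'n"
  assumes "is_drazin_inverse A B"
  shows "(\<lambda>k. (mat_power A k ** (A ** B)) $ a $ b,
      \<lambda>k. (mat_power B k - delta_seq 0 k *\<^sub>R spectral_proj0 A) $ a $ b) \<in> span basis_reflection_pairs"
proof -
  have "two_sided_powers A B (- int k) = mat_power B k - delta_seq 0 k *\<^sub>R spectral_proj0 A" for k
    by (simp add: two_sided_powers_def delta_seq_def spectral_proj0_eq[OF assms])
  moreover have "two_sided_powers A B (int k) = mat_power A k ** (A ** B)" for k
    by (simp add: two_sided_powers_def)
  ultimately show ?thesis
    using exp_poly_gives_pair[OF two_sided_powers_in_exp_poly[OF assms, of a b]] by simp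
qed

text \<open>For uniqueness, two geometric parts differ by finitely supported sequences; their difference
  has eventually vanishing, reflectable entries and so is zero.\<close>

lemma geometric_part_eq:
  fixes A :: "real^'n^'n"
  assumes "is_drazin_inverse A B"
  shows "geometric_part (S_tilde \<union> S_plus1 \<union> S_plus2) A = (\<lambda>k. mat_power A k ** (A ** B))"
    (is "geometric_part ?S A = ?G")
  unfolding geometric_part_def
proof (rule the_equality)
  obtain K where K: "\<And>k. k \<ge> K \<Longrightarrow> ?G k = mat_power A k"
    using drazin_eventually_stable[OF assms] by blast
  have "\<forall>a b. \<exists>f l. (\<forall>i. f i \<in> span ?S) \<and> (\<forall>m\<ge>l. \<forall>k. ?G k $ a $ b = (\<Sum>i\<le>m. Lambda_seq i k * f i k))"
    using reflected_sequence_grouping[OF matrix_powers_reflect[OF assms]] by simp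
  then obtain f l where f: "\<And>a b i. f a b i \<in> span ?S"
    "\<And>a b m k. m \<ge> l a b \<Longrightarrow> ?G k $ a $ b = (\<Sum>i\<le>m. Lambda_seq i k * f a b i k)"
    by metis
  define L where "L = Max (range (\<lambda>(a, b). l a b))"
  have L: "l a b \<le> L" for a b
    unfolding L_def by (rule Max_ge) (auto intro: rev_image_eqI[of "(a, b)"])
  define F where "F i k = (\<chi> a b. f a b i k)" for i k
  have G: "?G k = (\<Sum>i\<le>L. Lambda_seq i k *\<^sub>R F i k)" for k
    by (simp add: vec_eq_iff f(2)[OF L] F_def)
  have entries: "(\<lambda>k. F i k $ a $ b) \<in> span ?S" for i a b
    using f(1)[of a b i] by (simp add: F_def)
  have "(\<lambda>k. (mat_power A k - ?G k) $ a $ b) \<in> span S_circ" for a b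
    by (rule finite_support_in_span[of K]) (simp only: K diff_self zero_index)
  moreover have "mat_power A k = (mat_power A k - ?G k) + (\<Sum>i\<le>L. Lambda_seq i k *\<^sub>R F i k)" for k
    unfolding G[symmetric] by simp
  ultimately have "geometric_decomposition ?S A (\<lambda>k. mat_power A k - ?G k) L F"
    unfolding geometric_decomposition_def using entries by blast
  then show "\<exists>N l B. geometric_decomposition ?S A N l B \<and> ?G = (\<lambda>k. \<Sum>i\<le>l. Lambda_seq i k *\<^sub>R B i k)"
    using G by blast
next
  fix H
  assume "\<exists>N l F. geometric_decomposition ?S A N l F \<and> H = (\<lambda>k. \<Sum>i\<le>l. Lambda_seq i k *\<^sub>R F i k)"
  then obtain N l F where dec: "geometric_decomposition ?S A N l F"
    and H: "H = (\<lambda>k. \<Sum>i\<le>l. Lambda_seq i k *\<^sub>R F i k)" by blast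
  have N: "(\<lambda>k. N k $ a $ b) \<in> span S_circ"
    and F: "i \<le> l \<Longrightarrow> (\<lambda>k. F i k $ a $ b) \<in> span ?S"
    and A: "mat_power A k = N k + H k" for a b i k
    using dec by (auto simp: geometric_decomposition_def H)
  obtain K where K: "\<And>k. k \<ge> K \<Longrightarrow> ?G k = mat_power A k"
    using drazin_eventually_stable[OF assms] by blast
  show "H = ?G"
  proof -
    have "(\<lambda>k. H k $ a $ b) - (\<lambda>k. ?G k $ a $ b) = 0" for a b
    proof -
      obtain h where "(\<lambda>k. \<Sum>i\<le>l. Lambda_seq i k * F i k $ a $ b, h) \<in> span basis_reflection_pairs"
        using geometric_sum_reflects[of l "\<lambda>i k. F i k $ a $ b"] F by blast
      moreover have "(\<lambda>k. H k $ a $ b) = (\<lambda>k. \<Sum>i\<le>l. Lambda_seq i k * F i k $ a $ b)"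
        by (simp add: H)
      ultimately have "(\<lambda>k. H k $ a $ b, h) \<in> span basis_reflection_pairs" by simp
      from span_diff[OF this matrix_powers_reflect[OF assms, of a b]]
      obtain g where g: "((\<lambda>k. H k $ a $ b) - (\<lambda>k. ?G k $ a $ b), g) \<in> span basis_reflection_pairs"
        by auto
      obtain M where M: "\<And>k. k \<ge> M \<Longrightarrow> N k $ a $ b = 0"
        using span_finite_support[OF N[of a b]] by blast
      show ?thesis
      proof (rule reflection_of_eventually_zero(1)[OF g, of "max M K"])
        fix k assume k: "max M K \<le> k"
        have "N k + H k = ?G k" using A[of k] K[of k] k by simp
        then have "N k $ a $ b + H k $ a $ b = ?G k $ a $ b" by (metis vector_add_component)
        then show "((\<lambda>k. H k $ a $ b) - (\<lambda>k. ?G k $ a $ b)) k = 0" using M[of k] k by simp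
      qed
    qed
    then show ?thesis by (auto simp: fun_eq_iff vec_eq_iff)
  qed
qed

theorem proposition4p7:
  fixes A :: "real^'n^'n"
  shows "plug_neg_mat (geometric_part (S_tilde \<union> S_plus1 \<union> S_plus2) A) =
         (\<lambda>k. mat_power (drazin_inverse A) k - delta_seq 0 k *\<^sub>R spectral_proj0 A)"
proof -
  note D = is_drazin_inverse_drazin_inverse[of A]
  have "plug_neg (\<lambda>m. (mat_power A m ** (A ** drazin_inverse A)) $ a $ b)
      = (\<lambda>k. (mat_power (drazin_inverse A) k - delta_seq 0 k *\<^sub>R spectral_proj0 A) $ a $ b)" for a b
    by (rule plug_neg_eq) (rule matrix_powers_reflect[OF D])
  then show ?thesis
    by (simp add: plug_neg_mat_def geometric_part_eq[OF D] vec_eq_iff fun_eq_iff)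
qed

end
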